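(* Let $N$ and $H$ be finite groups, let $\varphi: H\to \mathrm{Aut}(N)$ be a homomorphism (write $\varphi_h=\varphi(h)$), and let $G=N\rtimes_\varphi H$. Let $D>0$ and suppose that $G$ is $D$-quasirandom on $N$. For $g=(z,h)\in G$ write $\dot g=h\in H$. For any integer $k\ge 2$ and any subsets $X_0,X_1,\ldots,X_k\subseteq G$, let \[ \mathcal{M}_k=\#\{(x_0,x_1,\ldots,x_k)\in X_0\times X_1\times\cdots\times X_k:\ x_1x_2\cdots x_k=x_0\}, \] \[ \dot{\mathcal{M}}_k=\#\{(x_0,x_1,\ldots,x_k)\in X_0\times X_1\times\cdots\times X_k:\ \dot{x_1}\dot{x_2}\cdots\dot{x_k}=\dot{x_0}\}. \] Then \[ \left|\mathcal{M}_k-\frac{1}{|N|}\dot{\mathcal{M}}_k\right|\le \sqrt{\frac{|G|^{k-1}|X_0||X_1|\cdots|X_k|}{D^{k-1}}}. \]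
   Context: The semi-direct product $G=N\rtimes_\varphi H$ is the set $\{(z,h): z\in N, h\in H\}$ with multiplication $(z_1,h_1)(z_2,h_2)=(z_1\varphi_{h_1}(z_2),h_1h_2)$. A complex representation $\rho$ of $G$ is of type II if there is $z\in N$ with $\rho((z,1_H))$ not the identity (otherwise it is lifted from a representation of $H\cong G/\{(z,1_H)\}$, called type I). For $D>0$, $G$ is called $D$-quasirandom on $N$ if every complex representation of $G$ of type II has degree at least $D$. *)

theory Defs
  imports Complex_Main "HOL-Algebra.Bij" "HOL-Algebra.Coset" "Jordan_Normal_Form.Matrix"
begin

definition semidirect_product ::
  "('a, 'm) monoid_scheme \<Rightarrow> ('b, 'n) monoid_scheme \<Rightarrow> ('b \<Rightarrow> 'a \<Rightarrow> 'a) \<Rightarrow> ('a \<times> 'b) monoid"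
where
  "semidirect_product N H \<phi> =
     \<lparr>carrier = carrier N \<times> carrier H,
      monoid.mult = \<lambda>(z\<^sub>1, h\<^sub>1) (z\<^sub>2, h\<^sub>2). (z\<^sub>1 \<otimes>\<^bsub>N\<^esub> \<phi> h\<^sub>1 z\<^sub>2, h\<^sub>1 \<otimes>\<^bsub>H\<^esub> h\<^sub>2),
      one = (\<one>\<^bsub>N\<^esub>, \<one>\<^bsub>H\<^esub>)\<rparr>"

lemma group_semidirect_product:
  assumes N: "group N" and H: "group H" and \<phi>: "\<phi> \<in> hom H (AutoGroup N)"
  shows "group (semidirect_product N H \<phi>)"
proof -
  interpret N: group N by fact
  interpret H: group H by fact
  have aut: "\<phi> h \<in> hom N N" "\<phi> h \<in> Bij (carrier N)" if "h \<in> carrier H" for h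
    using \<phi> that by (auto simp: hom_def AutoGroup_def auto_def)
  have closed [simp]: "\<phi> h z \<in> carrier N" if "h \<in> carrier H" "z \<in> carrier N" for h z
    using aut(1)[OF that(1)] that(2) by (auto simp: hom_def)
  have mult: "\<phi> h (y \<otimes>\<^bsub>N\<^esub> z) = \<phi> h y \<otimes>\<^bsub>N\<^esub> \<phi> h z"
    if "h \<in> carrier H" "y \<in> carrier N" "z \<in> carrier N" for h y z
    using aut(1)[OF that(1)] that(2,3) by (rule hom_mult)
  have comp: "\<phi> (g \<otimes>\<^bsub>H\<^esub> h) z = \<phi> g (\<phi> h z)"
    if "g \<in> carrier H" "h \<in> carrier H" "z \<in> carrier N" for g h z
  proof -
    have "\<phi> (g \<otimes>\<^bsub>H\<^esub> h) = \<phi> g \<otimes>\<^bsub>AutoGroup N\<^esub> \<phi> h"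
      using \<phi> that by (intro hom_mult)
    then show ?thesis
      using aut that by (simp add: AutoGroup_def BijGroup_def compose_eq)
  qed
  have "\<phi> \<one>\<^bsub>H\<^esub> = \<one>\<^bsub>AutoGroup N\<^esub>"
    using hom_one[OF \<phi> H N.AutoGroup] .
  then have one: "\<phi> \<one>\<^bsub>H\<^esub> z = z" if "z \<in> carrier N" for z
    using that by (simp add: AutoGroup_def BijGroup_def)
  show ?thesis
  proof (rule groupI)
    fix x assume "x \<in> carrier (semidirect_product N H \<phi>)"
    then obtain z h where x: "x = (z, h)" "z \<in> carrier N" "h \<in> carrier H"
      by (auto simp: semidirect_product_def)
    let ?y = "(\<phi> (inv\<^bsub>H\<^esub> h) (inv\<^bsub>N\<^esub> z), inv\<^bsub>H\<^esub> h)"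
    have "\<phi> (inv\<^bsub>H\<^esub> h) (inv\<^bsub>N\<^esub> z) \<otimes>\<^bsub>N\<^esub> \<phi> (inv\<^bsub>H\<^esub> h) z = \<one>\<^bsub>N\<^esub>"
      using x hom_one[OF aut(1) N N, of "inv\<^bsub>H\<^esub> h"] by (simp flip: mult)
    then show "\<exists>y\<in>carrier (semidirect_product N H \<phi>).
        y \<otimes>\<^bsub>semidirect_product N H \<phi>\<^esub> x = \<one>\<^bsub>semidirect_product N H \<phi>\<^esub>"
      using x by (intro bexI[of _ ?y]) (auto simp: semidirect_product_def)
  qed (auto simp: semidirect_product_def mult comp one N.m_assoc H.m_assoc)
qed

definition GL_complex :: "nat \<Rightarrow> complex mat monoid" where
  "GL_complex d = units_of (ring_mat TYPE(complex) d ())"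

text \<open>A complex representation of degree \<open>d\<close>, in matrix form.\<close>

definition complex_representation ::
  "('g, 'm) monoid_scheme \<Rightarrow> nat \<Rightarrow> ('g \<Rightarrow> complex mat) \<Rightarrow> bool"
where
  "complex_representation G d \<rho> \<longleftrightarrow> \<rho> \<in> hom G (GL_complex d)"

definition type_II_representation ::
  "('a, 'm) monoid_scheme \<Rightarrow> ('b, 'n) monoid_scheme \<Rightarrow> ('b \<Rightarrow> 'a \<Rightarrow> 'a) \<Rightarrow>
   nat \<Rightarrow> ('a \<times> 'b \<Rightarrow> complex mat) \<Rightarrow> bool"
where
  "type_II_representation N H \<phi> d \<rho> \<longleftrightarrow>
     complex_representation (semidirect_product N H \<phi>) d \<rho> \<and>
     (\<exists>z\<in>carrier N. \<rho> (z, \<one>\<^bsub>H\<^esub>) \<noteq> 1\<^sub>m d)"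

definition quasirandom_on ::
  "real \<Rightarrow> ('a, 'm) monoid_scheme \<Rightarrow> ('b, 'n) monoid_scheme \<Rightarrow> ('b \<Rightarrow> 'a \<Rightarrow> 'a) \<Rightarrow> bool"
where
  "quasirandom_on D N H \<phi> \<longleftrightarrow>
     (\<forall>d \<rho>. type_II_representation N H \<phi> d \<rho> \<longrightarrow> D \<le> real d)"

text \<open>The ordered product \<open>x 1 \<otimes> x 2 \<otimes> \<dots> \<otimes> x k\<close>; the index \<open>0\<close> does not occur in it.\<close>

definition ordered_prod :: "('g, 'm) monoid_scheme \<Rightarrow> nat \<Rightarrow> (nat \<Rightarrow> 'g) \<Rightarrow> 'g" where
  "ordered_prod G k x = foldr (\<otimes>\<^bsub>G\<^esub>) (map x [1..<Suc k]) \<one>\<^bsub>G\<^esub>"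

text \<open>Tuples \<open>(x\<^sub>0, \<dots>, x\<^sub>k)\<close> in \<open>X\<^sub>0 \<times> \<dots> \<times> X\<^sub>k\<close> are the elements of \<open>PiE {..k} X\<close>. The second
  count compares only the \<open>H\<close>-components of the tuples, which still range over subsets of
  the semidirect product.\<close>

definition solution_count ::
  "('a, 'm) monoid_scheme \<Rightarrow> ('b, 'n) monoid_scheme \<Rightarrow> ('b \<Rightarrow> 'a \<Rightarrow> 'a) \<Rightarrow>
   nat \<Rightarrow> (nat \<Rightarrow> ('a \<times> 'b) set) \<Rightarrow> nat"
where
  "solution_count N H \<phi> k X =
     card {x \<in> PiE {..k} X. ordered_prod (semidirect_product N H \<phi>) k x = x 0}"

definition projected_solution_count ::
  "('b, 'n) monoid_scheme \<Rightarrow> nat \<Rightarrow> (nat \<Rightarrow> ('a \<times> 'b) set) \<Rightarrow> nat"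
where
  "projected_solution_count H k X =
     card {x \<in> PiE {..k} X. ordered_prod H k (\<lambda>i. snd (x i)) = snd (x 0)}"

end

theory Submission
  imports Defs "HOL-Analysis.Function_Topology" "HOL-Analysis.Convex"
begin

text \<open>
  Let \<open>K = N \<times> {1}\<close> and let \<open>F\<close> be a function on \<open>G\<close> with mean zero on every coset of \<open>K\<close>. Suppose that
  \<open>T g = F * g\<close> has squared norm \<open>L > 0\<close> on \<open>L\<^sup>2(G)\<close>. The vectors on which \<open>T\<close> attains its norm form
  a subspace, which is invariant under right translations because these are isometries commuting with \<open>T\<close>.
  It contains no nonzero \<open>K\<close>-invariant vector, as \<open>T\<close> kills those. So it carries a representation
  of type II, and its dimension \<open>m\<close> is at least \<open>D\<close>. On the other hand \<open>m L\<close> is at most the squared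
  Hilbert--Schmidt norm \<open>|G| \<parallel>F\<parallel>\<^sup>2\<close> of \<open>T\<close>, whence \<open>\<parallel>F * g\<parallel>\<^sup>2 \<le> |G| / D \<parallel>F\<parallel>\<^sup>2 \<parallel>g\<parallel>\<^sup>2\<close>.

  Subtracting coset means commutes with convolution, and the difference of the two counts is the inner
  product of the indicator of \<open>X\<^sub>0\<close> with \<open>F\<^sub>1 * f\<^sub>2 * \<dots> * f\<^sub>k\<close>, where \<open>f\<^sub>i\<close> is the indicator of \<open>X\<^sub>i\<close> and
  \<open>F\<^sub>1\<close> is \<open>f\<^sub>1\<close> minus its coset means. Apply the bound \<open>k - 1\<close> times and then Cauchy--Schwarz.
\<close>

section \<open>Real inner product of functions on a finite set\<close>

definition dot_on :: "'g set \<Rightarrow> ('g \<Rightarrow> real) \<Rightarrow> ('g \<Rightarrow> real) \<Rightarrow> real" where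
  "dot_on S f g = (\<Sum>x\<in>S. f x * g x)"

lemma dot_on_add_left: "dot_on S (\<lambda>x. f x + g x) h = dot_on S f h + dot_on S g h"
  by (simp add: dot_on_def distrib_right sum.distrib)

lemma dot_on_diff_left: "dot_on S (\<lambda>x. f x - g x) h = dot_on S f h - dot_on S g h"
  by (simp add: dot_on_def left_diff_distrib sum_subtractf)

lemma dot_on_scale_left: "dot_on S (\<lambda>x. c * f x) h = c * dot_on S f h"
  by (simp add: dot_on_def sum_distrib_left mult.assoc)

lemma dot_on_sum_left: "dot_on S (\<lambda>x. \<Sum>i\<in>I. f i x) h = (\<Sum>i\<in>I. dot_on S (f i) h)"
  unfolding dot_on_def sum_distrib_right by (rule sum.swap)

lemma dot_on_commute: "dot_on S f g = dot_on S g f"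
  by (simp add: dot_on_def mult.commute)

lemma dot_on_add_right: "dot_on S h (\<lambda>x. f x + g x) = dot_on S h f + dot_on S h g"
  by (simp add: dot_on_def distrib_left sum.distrib)

lemma dot_on_diff_right: "dot_on S h (\<lambda>x. f x - g x) = dot_on S h f - dot_on S h g"
  by (simp add: dot_on_def right_diff_distrib sum_subtractf)

lemma dot_on_scale_right: "dot_on S h (\<lambda>x. c * f x) = c * dot_on S h f"
  by (simp add: dot_on_def sum_distrib_left mult.left_commute)

lemma dot_on_sum_right: "dot_on S h (\<lambda>x. \<Sum>i\<in>I. f i x) = (\<Sum>i\<in>I. dot_on S h (f i))"
  unfolding dot_on_def sum_distrib_left by (rule sum.swap)

lemmas dot_on_linear = dot_on_add_left dot_on_diff_left dot_on_scale_left
  dot_on_add_right dot_on_diff_right dot_on_scale_right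

lemma dot_on_self_nonneg [simp]: "dot_on S f f \<ge> 0"
  by (simp add: dot_on_def sum_nonneg)

lemma dot_on_self_eq_0: "finite S \<Longrightarrow> dot_on S f f = 0 \<longleftrightarrow> (\<forall>x\<in>S. f x = 0)"
  by (simp add: dot_on_def sum_nonneg_eq_0_iff)

lemma dot_on_cong:
  "(\<And>x. x \<in> S \<Longrightarrow> f x = f' x) \<Longrightarrow> (\<And>x. x \<in> S \<Longrightarrow> g x = g' x) \<Longrightarrow> dot_on S f g = dot_on S f' g'"
  by (simp add: dot_on_def)

lemma dot_on_Cauchy_Schwarz: "(dot_on S f g)\<^sup>2 \<le> dot_on S f f * dot_on S g g"
  using Cauchy_Schwarz_ineq_sum[of f g S] by (simp add: dot_on_def power2_eq_square)

section \<open>Orthonormal families and bases\<close>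

definition orthonormal_on :: "'g set \<Rightarrow> nat \<Rightarrow> (nat \<Rightarrow> 'g \<Rightarrow> real) \<Rightarrow> bool" where
  "orthonormal_on S m u \<longleftrightarrow> (\<forall>i<m. \<forall>j<m. dot_on S (u i) (u j) = (if i = j then 1 else 0))"

lemma orthonormal_on_dot_residual:
  assumes "orthonormal_on S m u" "j < m"
  shows "dot_on S (\<lambda>x. f x - (\<Sum>i<m. dot_on S f (u i) * u i x)) (u j) = 0"
proof -
  have "(\<Sum>i<m. dot_on S f (u i) * dot_on S (u i) (u j)) = (\<Sum>i<m. if i = j then dot_on S f (u i) else 0)"
    using assms by (intro sum.cong) (auto simp: orthonormal_on_def)
  then show ?thesis
    using assms(2) by (simp add: dot_on_diff_left dot_on_sum_left dot_on_scale_left)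
qed

lemma Bessel_on:
  assumes "orthonormal_on S m u"
  shows "(\<Sum>i<m. (dot_on S f (u i))\<^sup>2) \<le> dot_on S f f"
proof -
  define p where "p x = (\<Sum>i<m. dot_on S f (u i) * u i x)" for x
  have fp: "dot_on S f p = (\<Sum>i<m. (dot_on S f (u i))\<^sup>2)"
    unfolding p_def by (simp add: dot_on_sum_right dot_on_scale_right power2_eq_square)
  \<comment> \<open>\<open>p\<close> is the projection of \<open>f\<close> to the span of the
    \<open>u i\<close>, so \<open>f - p\<close> is orthogonal to \<open>p\<close>. Bessel's
    inequality is then the nonnegativity of the squared norm of \<open>f - p\<close>.\<close>
  have "dot_on S (\<lambda>x. f x - p x) p = 0"
    using orthonormal_on_dot_residual[OF assms, of _ f]
    by (subst (2) p_def[abs_def]) (simp add: dot_on_sum_right dot_on_scale_right p_def[abs_def])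
  then have "dot_on S p p = dot_on S f p"
    by (simp add: dot_on_diff_left)
  moreover have "0 \<le> dot_on S (\<lambda>x. f x - p x) (\<lambda>x. f x - p x)"
    by simp
  ultimately show ?thesis
    using fp by (simp add: dot_on_linear dot_on_commute[of S p f])
qed

text \<open>Bessel's inequality for the point mass at \<open>x\<close> bounds the sum of the
  \<open>(u i x)\<^sup>2\<close> by 1. Summing over \<open>x\<close> in \<open>S\<close> counts each
  unit vector \<open>u i\<close> once.\<close>

lemma orthonormal_on_card_le:
  assumes "finite S" "orthonormal_on S m u"
  shows "m \<le> card S"
proof -
  have point: "dot_on S (\<lambda>y. if y = x then 1 else 0) g = g x" if "x \<in> S" for x g
  proof -
    have "dot_on S (\<lambda>y. if y = x then 1 else 0) g = (\<Sum>y\<in>S. if y = x then g y else 0)"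
      unfolding dot_on_def by (rule sum.cong) auto
    then show ?thesis using that assms(1) by simp
  qed
  have le: "(\<Sum>i<m. (u i x)\<^sup>2) \<le> 1" if "x \<in> S" for x
    using Bessel_on[OF assms(2), of "\<lambda>y. if y = x then 1 else 0"] that by (simp add: point)
  have "real m = (\<Sum>i<m. dot_on S (u i) (u i))"
    using assms(2) by (simp add: orthonormal_on_def)
  also have "\<dots> = (\<Sum>x\<in>S. \<Sum>i<m. (u i x)\<^sup>2)"
    unfolding dot_on_def power2_eq_square by (rule sum.swap)
  also have "\<dots> \<le> (\<Sum>x\<in>S. 1)"
    by (intro sum_mono le)
  finally show ?thesis by simp
qed

text \<open>An orthonormal family in \<open>V\<close> of maximal size works: if some
  \<open>f\<close> in \<open>V\<close> had a nonzero residual, this residual, normalised, would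
  extend the family. The expansion is claimed on \<open>S\<close> only, since values elsewhere are
  invisible to \<open>dot_on\<close>.\<close>

lemma orthonormal_basis_on_exists:
  assumes "finite S"
    and add: "\<And>f g. f \<in> V \<Longrightarrow> g \<in> V \<Longrightarrow> (\<lambda>x. f x + g x) \<in> V"
    and scale: "\<And>c f. f \<in> V \<Longrightarrow> (\<lambda>x. c * f x) \<in> V"
  obtains m u where "orthonormal_on S m u" "\<And>i. i < m \<Longrightarrow> u i \<in> V"
    "\<And>f x. f \<in> V \<Longrightarrow> x \<in> S \<Longrightarrow> f x = (\<Sum>i<m. dot_on S f (u i) * u i x)"
proof -
  define P where "P m \<longleftrightarrow> (\<exists>u. orthonormal_on S m u \<and> (\<forall>i<m. u i \<in> V))" for m
  have "P 0" by (simp add: P_def orthonormal_on_def)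
  moreover have bound: "\<forall>m. P m \<longrightarrow> m \<le> card S"
    using orthonormal_on_card_le[OF assms(1)] by (auto simp: P_def)
  ultimately obtain m where m: "P m" and max: "\<And>n. P n \<Longrightarrow> n \<le> m"
    using Nat.ex_has_greatest_nat[of P 0 "card S"] by metis
  then obtain u where u: "orthonormal_on S m u" "\<And>i. i < m \<Longrightarrow> u i \<in> V"
    by (auto simp: P_def)
  have sum_mem: "(\<lambda>x. f x + (\<Sum>i<n. c i * u i x)) \<in> V" if "f \<in> V" "n \<le> m" for n c f
    using that(2)
  proof (induction n)
    case 0 then show ?case using that by simp
  next
    case (Suc n)
    then have "(\<lambda>x. f x + (\<Sum>i<n. c i * u i x)) \<in> V" "u n \<in> V"
      by (simp_all add: u(2))
    from add[OF this(1) scale[OF this(2), of "c n"]]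
    have "(\<lambda>x. (f x + (\<Sum>i<n. c i * u i x)) + c n * u n x) \<in> V" .
    then show ?case by (simp add: add.assoc)
  qed
  have "f x = (\<Sum>i<m. dot_on S f (u i) * u i x)" if f: "f \<in> V" and x: "x \<in> S" for f x
  proof (rule ccontr)
    define r where "r x = f x - (\<Sum>i<m. dot_on S f (u i) * u i x)" for x
    define c where "c = dot_on S r r"
    assume "f x \<noteq> (\<Sum>i<m. dot_on S f (u i) * u i x)"
    then have "c \<noteq> 0"
      unfolding c_def using x dot_on_self_eq_0[OF assms(1)] by (auto simp: r_def)
    then have c: "c > 0"
      using dot_on_self_nonneg[of S r] unfolding c_def by linarith
    have r: "r \<in> V"
      using sum_mem[OF f order.refl, of "\<lambda>i. - dot_on S f (u i)"]
      by (simp add: r_def[abs_def] sum_negf)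
    define u' where "u' = u(m := \<lambda>x. (1 / sqrt c) * r x)"
    have ru: "dot_on S r (u j) = 0" if "j < m" for j
      using orthonormal_on_dot_residual[OF u(1) that, of f] by (simp add: r_def[abs_def])
    have u'_m: "u' m = (\<lambda>x. (1 / sqrt c) * r x)" and u'_less: "\<And>j. j < m \<Longrightarrow> u' j = u j"
      by (auto simp: u'_def)
    have mm: "dot_on S (u' m) (u' m) = 1"
      unfolding u'_m dot_on_linear c_def[symmetric] using c by simp
    have mj: "dot_on S (u' m) (u' j) = 0" if "j < m" for j
      unfolding u'_m u'_less[OF that] dot_on_scale_left ru[OF that] by simp
    have "orthonormal_on S (Suc m) u'"
      unfolding orthonormal_on_def
    proof (intro allI impI)
      fix i j assume "i < Suc m" "j < Suc m"
      then consider "i = m" "j = m" | "i = m" "j < m" | "i < m" "j = m" | "i < m" "j < m"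
        by linarith
      then show "dot_on S (u' i) (u' j) = (if i = j then 1 else 0)"
      proof cases
        case 1 then show ?thesis using mm by simp
      next
        case 2 then show ?thesis using mj[of j] by simp
      next
        case 3 then show ?thesis using mj[of i] dot_on_commute[of S "u' i" "u' m"] by simp
      next
        case 4 then show ?thesis using u(1) by (simp add: orthonormal_on_def u'_less)
      qed
    qed
    moreover have "u' i \<in> V" if "i < Suc m" for i
    proof (cases "i = m")
      case True
      show ?thesis unfolding True u'_m by (rule scale[OF r])
    next
      case False
      then have "i < m" using that by simp
      then show ?thesis unfolding u'_less[OF \<open>i < m\<close>] by (rule u(2))
    qed
    ultimately have "P (Suc m)"
      unfolding P_def by (intro exI[of _ u'] conjI allI impI)
    from max[OF this] show False by simp
  qed
  from that[OF u this] show thesis .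
qed

section \<open>Operators given by a real kernel\<close>

definition kernel_on :: "'g set \<Rightarrow> ('g \<Rightarrow> 'g \<Rightarrow> real) \<Rightarrow> ('g \<Rightarrow> real) \<Rightarrow> 'g \<Rightarrow> real" where
  "kernel_on S a f x = dot_on S (a x) f"

lemma continuous_on_coordinate [continuous_intros]: "continuous_on A (\<lambda>f. f i :: real)"
  by (rule continuous_on_subset[OF continuous_on_product_coordinates]) simp

text \<open>The unit sphere of a finite-dimensional space is compact, so the squared norm of the
  image attains a maximum \<open>L\<close> there. Homogeneity extends the bound to all
  functions.\<close>

lemma kernel_on_norm_attained:
  assumes S: "finite S" "S \<noteq> {}"
  obtains L f where "dot_on S f f = 1" "dot_on S (kernel_on S a f) (kernel_on S a f) = L"
    "\<And>g. dot_on S (kernel_on S a g) (kernel_on S a g) \<le> L * dot_on S g g"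
proof -
  define q where "q f = dot_on S (kernel_on S a f) (kernel_on S a f)" for f
  \<comment> \<open>Functions are defined on the whole type. Forcing them to vanish off
    \<open>S\<close> makes \<open>B\<close> a product of compact sets, so that Tychonoff's theorem
    applies.\<close>
  define B where "B = PiE UNIV (\<lambda>x. if x \<in> S then {-1..1::real} else {0})"
  define C where "C = B \<inter> {f. dot_on S f f = 1}"
  have cont_q: "continuous_on A q" for A
    unfolding q_def[abs_def] dot_on_def kernel_on_def by (intro continuous_intros)
  have "compact B"
    using compactin_PiE[of "\<lambda>_. euclidean" UNIV "\<lambda>x. if x \<in> S then {-1..1::real} else {0}"]
    by (simp add: B_def euclidean_product_topology)
  moreover have "closed {f. dot_on S f f = 1}"
    unfolding dot_on_def by (intro closed_Collect_eq continuous_intros)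
  ultimately have "compact C"
    unfolding C_def by (rule compact_Int_closed)
  obtain s where s: "s \<in> S" using S by blast
  have "(\<lambda>x. if x = s then 1 else 0) \<in> C"
    using s S(1) by (auto simp: C_def B_def dot_on_def if_distrib cong: if_cong)
  then have "C \<noteq> {}" by blast
  from continuous_attains_sup[OF \<open>compact C\<close> this cont_q] obtain f
    where f: "f \<in> C" "\<And>g. g \<in> C \<Longrightarrow> q g \<le> q f" by blast
  have "q g \<le> q f * dot_on S g g" for g
  proof (cases "dot_on S g g = 0")
    case True
    then have "\<forall>x\<in>S. g x = 0" using dot_on_self_eq_0[OF S(1)] by blast
    then show ?thesis by (simp add: q_def kernel_on_def dot_on_def)
  next
    case False
    define c where "c = dot_on S g g"
    have c: "c > 0" using False dot_on_self_nonneg[of S g] unfolding c_def by linarith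
    \<comment> \<open>Besides being normalised, \<open>g\<close> is cut off outside \<open>S\<close>
      to land in \<open>B\<close>; the operator does not see the difference.\<close>
    define h where "h x = (if x \<in> S then (1 / sqrt c) * g x else 0)" for x
    have "dot_on S h h = dot_on S (\<lambda>x. (1 / sqrt c) * g x) (\<lambda>x. (1 / sqrt c) * g x)"
      by (rule dot_on_cong) (auto simp: h_def)
    also have "\<dots> = 1"
      unfolding dot_on_linear c_def[symmetric] using c by simp
    finally have h1: "dot_on S h h = 1" .
    have "\<bar>h x\<bar> \<le> 1" if "x \<in> S" for x
    proof -
      have "h x * h x \<le> dot_on S h h"
        unfolding dot_on_def by (rule member_le_sum[OF that]) (auto simp: S)
      then show ?thesis using h1 by (simp add: abs_square_le_1 flip: power2_eq_square)
    qed
    moreover have "h x = 0" if "x \<notin> S" for x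
      using that by (simp add: h_def)
    ultimately have "h \<in> B"
      unfolding B_def by (auto simp: abs_le_iff minus_le_iff)
    then have "q h \<le> q f"
      using h1 by (intro f) (simp add: C_def)
    moreover have "kernel_on S a h x = (1 / sqrt c) * kernel_on S a g x" for x
    proof -
      have "kernel_on S a h x = dot_on S (a x) (\<lambda>x. (1 / sqrt c) * g x)"
        unfolding kernel_on_def by (rule dot_on_cong) (auto simp: h_def)
      then show ?thesis by (simp only: dot_on_linear kernel_on_def)
    qed
    then have "q h = q g / c"
      unfolding q_def dot_on_def using c by (simp add: sum_divide_distrib)
    ultimately show ?thesis
      using c by (simp add: c_def field_simps)
  qed
  with f(1) show thesis
    by (intro that[of f]) (auto simp: C_def q_def)
qed

text \<open>Apply the bound to \<open>f + g\<close> and \<open>f - g\<close>: by the parallelogram law, both inequalities are equalities.\<close>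

lemma norm_attaining_add:
  assumes bound: "\<And>g. dot_on S (kernel_on S a g) (kernel_on S a g) \<le> L * dot_on S g g"
    and f: "dot_on S (kernel_on S a f) (kernel_on S a f) = L * dot_on S f f"
    and g: "dot_on S (kernel_on S a g) (kernel_on S a g) = L * dot_on S g g"
  shows "dot_on S (kernel_on S a (\<lambda>x. f x + g x)) (kernel_on S a (\<lambda>x. f x + g x))
    = L * dot_on S (\<lambda>x. f x + g x) (\<lambda>x. f x + g x)"
proof -
  have T: "kernel_on S a (\<lambda>x. f x + g x) = (\<lambda>x. kernel_on S a f x + kernel_on S a g x)"
    "kernel_on S a (\<lambda>x. f x - g x) = (\<lambda>x. kernel_on S a f x - kernel_on S a g x)"
    by (auto simp: kernel_on_def dot_on_linear)
  show ?thesis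
    using bound[of "\<lambda>x. f x + g x"] bound[of "\<lambda>x. f x - g x"] f g
    unfolding T by (simp add: dot_on_linear algebra_simps)
qed

text \<open>Bessel's inequality for each row \<open>a x\<close>. The right-hand side is the squared
  Hilbert-Schmidt norm of the operator.\<close>

lemma kernel_on_trace_bound:
  assumes "orthonormal_on S m u"
  shows "(\<Sum>i<m. dot_on S (kernel_on S a (u i)) (kernel_on S a (u i)))
    \<le> (\<Sum>x\<in>S. dot_on S (a x) (a x))"
proof -
  have "(\<Sum>i<m. dot_on S (kernel_on S a (u i)) (kernel_on S a (u i)))
    = (\<Sum>x\<in>S. \<Sum>i<m. (dot_on S (a x) (u i))\<^sup>2)"
    unfolding dot_on_def[of S "kernel_on S a (u _)"] kernel_on_def power2_eq_square by (rule sum.swap)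
  also have "\<dots> \<le> (\<Sum>x\<in>S. dot_on S (a x) (a x))"
    by (intro sum_mono Bessel_on assms)
  finally show ?thesis .
qed

text \<open>Serves twice: to detach the last factor of a product, and to detach the target
  coordinate 0 from the factors.\<close>

lemma sum_PiE_insert:
  assumes "i \<notin> I"
  shows "(\<Sum>x\<in>PiE (insert i I) X. h x) = (\<Sum>a\<in>X i. \<Sum>x\<in>PiE I X. h (x(i := a)))"
proof -
  have "(\<Sum>x\<in>PiE (insert i I) X. h x) = (\<Sum>p\<in>X i \<times> PiE I X. h ((snd p)(i := fst p)))"
    unfolding PiE_insert_eq using inj_combinator[OF assms, of X]
    by (subst sum.reindex) (simp_all add: split_beta o_def)
  then show ?thesis
    by (simp add: sum.cartesian_product split_beta)
qed

section \<open>Convolution on a finite group with a normal subgroup\<close>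

locale finite_normal = normal K G for K and G (structure) +
  assumes finite_carrier: "finite (carrier G)"
begin

lemma finite_K: "finite K"
  using finite_subset[OF subset finite_carrier] .

lemma card_K_pos: "card K > 0"
  using finite_K subgroup.one_closed[OF subgroup_axioms] by (metis card_gt_0_iff empty_iff)

lemma sum_translate_right:
  assumes "a \<in> carrier G"
  shows "(\<Sum>x\<in>carrier G. h (x \<otimes> a)) = (\<Sum>x\<in>carrier G. h x :: real)"
  by (rule sum.reindex_bij_witness[of _ "\<lambda>x. x \<otimes> inv a" "\<lambda>x. x \<otimes> a"])
    (use assms in \<open>auto simp: m_assoc\<close>)

lemma sum_inv_translate:
  assumes "a \<in> carrier G"
  shows "(\<Sum>x\<in>carrier G. h (a \<otimes> inv x)) = (\<Sum>x\<in>carrier G. h x :: real)"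
  by (rule sum.reindex_bij_witness[of _ "\<lambda>x. inv x \<otimes> a" "\<lambda>x. a \<otimes> inv x"])
    (use assms in \<open>auto simp: m_assoc inv_mult_group simp flip: m_assoc[of a "inv a"]\<close>)

lemma sum_K_translate:
  assumes "a \<in> K"
  shows "(\<Sum>z\<in>K. h (a \<otimes> z)) = (\<Sum>z\<in>K. h z :: real)"
  by (rule sum.reindex_bij_witness[of _ "\<lambda>z. inv a \<otimes> z" "\<lambda>z. a \<otimes> z"])
    (use assms in \<open>auto simp flip: m_assoc\<close>)

text \<open>Since \<open>K\<close> is normal, conjugation by \<open>y\<close> permutes it, and this
  moves \<open>z\<close> past \<open>y\<close>.\<close>

lemma sum_K_conj:
  assumes "x \<in> carrier G" "y \<in> carrier G"
  shows "(\<Sum>z\<in>K. h (x \<otimes> z \<otimes> y)) = (\<Sum>z\<in>K. h (x \<otimes> y \<otimes> z) :: real)"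
proof (rule sum.reindex_bij_witness[of _ "\<lambda>z. y \<otimes> z \<otimes> inv y" "\<lambda>z. inv y \<otimes> z \<otimes> y"])
  fix z assume z: "z \<in> K"
  then have [simp]: "z \<in> carrier G" by simp
  show "inv y \<otimes> z \<otimes> y \<in> K" "y \<otimes> z \<otimes> inv y \<in> K"
    using z assms by (auto intro: inv_op_closed1 inv_op_closed2)
  show "y \<otimes> (inv y \<otimes> z \<otimes> y) \<otimes> inv y = z" "inv y \<otimes> (y \<otimes> z \<otimes> inv y) \<otimes> y = z"
    using assms by (simp_all add: m_assoc inv_solve_left')
      (simp_all flip: m_assoc)
  show "h (x \<otimes> y \<otimes> (inv y \<otimes> z \<otimes> y)) = h (x \<otimes> z \<otimes> y)"
    using assms by (simp add: m_assoc inv_solve_left') (simp flip: m_assoc)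
qed

definition conv :: "('a \<Rightarrow> real) \<Rightarrow> ('a \<Rightarrow> real) \<Rightarrow> 'a \<Rightarrow> real" where
  "conv f g x = (\<Sum>y\<in>carrier G. f (x \<otimes> inv y) * g y)"

text \<open>The orthogonal projection to the functions that are constant on the cosets of
  \<open>K\<close>; \<open>dev\<close> below is the complementary projection.\<close>

definition avg :: "('a \<Rightarrow> real) \<Rightarrow> 'a \<Rightarrow> real" where
  "avg f x = (\<Sum>z\<in>K. f (x \<otimes> z)) / card K"

definition dev :: "('a \<Rightarrow> real) \<Rightarrow> 'a \<Rightarrow> real" where
  "dev f x = f x - avg f x"

abbreviation norm2 :: "('a \<Rightarrow> real) \<Rightarrow> real" where
  "norm2 f \<equiv> dot_on (carrier G) f f"

lemma conv_eq_kernel_on: "conv f = kernel_on (carrier G) (\<lambda>x y. f (x \<otimes> inv y))"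
  by (intro ext) (simp add: conv_def kernel_on_def dot_on_def)

text \<open>The kernel depends on \<open>x \<otimes> inv y\<close> only, which is unchanged when
  \<open>x\<close> and \<open>y\<close> are both multiplied by \<open>a\<close> on the
  right.\<close>

lemma conv_translate:
  assumes "x \<in> carrier G" "a \<in> carrier G"
  shows "conv f (\<lambda>y. g (y \<otimes> a)) x = conv f g (x \<otimes> a)"
proof -
  have "conv f g (x \<otimes> a) = (\<Sum>y\<in>carrier G. f (x \<otimes> a \<otimes> inv (y \<otimes> a)) * g (y \<otimes> a))"
    unfolding conv_def by (rule sum_translate_right[OF assms(2), symmetric])
  also have "\<dots> = conv f (\<lambda>y. g (y \<otimes> a)) x"
    unfolding conv_def
  proof (intro sum.cong refl)
    fix y assume "y \<in> carrier G"
    then have "x \<otimes> a \<otimes> inv (y \<otimes> a) = x \<otimes> inv y"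
      using assms by (simp add: inv_mult_group m_assoc) (simp flip: m_assoc)
    then show "f (x \<otimes> a \<otimes> inv (y \<otimes> a)) * g (y \<otimes> a) = f (x \<otimes> inv y) * g (y \<otimes> a)" by simp
  qed
  finally show ?thesis ..
qed

text \<open>Replacing \<open>y\<close> by \<open>y \<otimes> inv z\<close> leaves \<open>g\<close>
  fixed and inserts \<open>z\<close> into the argument of \<open>f\<close>. Summing over
  \<open>z\<close> in \<open>K\<close> then gives, by normality, sums of \<open>f\<close> over whole
  cosets.\<close>

lemma conv_eq_0:
  assumes f: "\<And>x. x \<in> carrier G \<Longrightarrow> (\<Sum>z\<in>K. f (x \<otimes> z)) = 0"
    and g: "\<And>y z. y \<in> carrier G \<Longrightarrow> z \<in> K \<Longrightarrow> g (y \<otimes> z) = g y"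
    and x: "x \<in> carrier G"
  shows "conv f g x = 0"
proof -
  have "conv f g x = (\<Sum>y\<in>carrier G. f (x \<otimes> z \<otimes> inv y) * g y)" if z: "z \<in> K" for z
  proof -
    have "conv f g x = (\<Sum>y\<in>carrier G. f (x \<otimes> inv (y \<otimes> inv z)) * g (y \<otimes> inv z))"
      unfolding conv_def using z by (intro sum_translate_right[symmetric]) auto
    also have "\<dots> = (\<Sum>y\<in>carrier G. f (x \<otimes> z \<otimes> inv y) * g y)"
      using z x by (intro sum.cong refl arg_cong2[of _ _ _ _ "(*)"])
        (auto simp: g inv_mult_group m_assoc)
    finally show ?thesis .
  qed
  then have "(\<Sum>z\<in>K. conv f g x) = (\<Sum>z\<in>K. \<Sum>y\<in>carrier G. f (x \<otimes> z \<otimes> inv y) * g y)"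
    by (rule sum.cong[OF refl])
  also have "\<dots> = (\<Sum>y\<in>carrier G. (\<Sum>z\<in>K. f (x \<otimes> z \<otimes> inv y)) * g y)"
    unfolding sum_distrib_right by (rule sum.swap)
  also have "\<dots> = 0"
    using x by (intro sum.neutral) (simp add: sum_K_conj f)
  finally show ?thesis
    using card_K_pos by simp
qed

lemma avg_translate:
  assumes "x \<in> carrier G" "z \<in> K"
  shows "avg f (x \<otimes> z) = avg f x"
proof -
  have "(\<Sum>w\<in>K. f (x \<otimes> z \<otimes> w)) = (\<Sum>w\<in>K. f (x \<otimes> (z \<otimes> w)))"
    using assms by (intro sum.cong) (auto simp: m_assoc)
  then show ?thesis
    using sum_K_translate[OF assms(2), of "\<lambda>w. f (x \<otimes> w)"] by (simp add: avg_def)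
qed

lemma sum_K_dev:
  assumes "x \<in> carrier G"
  shows "(\<Sum>z\<in>K. dev f (x \<otimes> z)) = 0"
  using card_K_pos assms by (simp add: dev_def sum_subtractf avg_translate) (simp add: avg_def)

lemma norm2_dev_le: "norm2 (dev f) \<le> norm2 f"
proof -
  let ?S = "carrier G"
  \<comment> \<open>As \<open>avg f\<close> is constant on cosets, translating \<open>f\<close> by
    \<open>z\<close> does not change the inner product. Averaging over \<open>z\<close> turns
    \<open>f\<close> into \<open>avg f\<close>, and Pythagoras finishes.\<close>
  have "dot_on ?S (avg f) f = dot_on ?S (avg f) (\<lambda>x. f (x \<otimes> z))" if z: "z \<in> K" for z
    unfolding dot_on_def using z
    by (subst sum_translate_right[symmetric, of z]) (auto intro!: sum.cong simp: avg_translate)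
  then have "(\<Sum>z\<in>K. dot_on ?S (avg f) f) = (\<Sum>z\<in>K. dot_on ?S (avg f) (\<lambda>x. f (x \<otimes> z)))"
    by (rule sum.cong[OF refl])
  also have "\<dots> = dot_on ?S (avg f) (\<lambda>x. card K * avg f x)"
    using card_K_pos by (simp add: avg_def flip: dot_on_sum_right)
  also have "\<dots> = card K * norm2 (avg f)"
    by (rule dot_on_scale_right)
  finally have "dot_on ?S (avg f) f = norm2 (avg f)"
    using card_K_pos by simp
  then have "norm2 (dev f) = norm2 f - norm2 (avg f)"
    unfolding dev_def[abs_def] dot_on_linear dot_on_commute[of ?S f "avg f"] by simp
  then show ?thesis by simp
qed

lemma conv_dev:
  assumes "x \<in> carrier G"
  shows "conv (dev f) g x = dev (conv f g) x"
proof -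
  have "avg (conv f g) x = (\<Sum>y\<in>carrier G. \<Sum>z\<in>K. f (x \<otimes> z \<otimes> inv y) * g y) / card K"
    unfolding avg_def conv_def by (subst sum.swap) simp
  also have "\<dots> = (\<Sum>y\<in>carrier G. avg f (x \<otimes> inv y) * g y)"
    using assms
    by (simp add: avg_def sum_divide_distrib[of _ "carrier G"] sum_K_conj flip: sum_distrib_right)
  finally show ?thesis
    by (simp add: dev_def conv_def left_diff_distrib sum_subtractf)
qed

section \<open>The norm bound for convolution operators\<close>

text \<open>Cauchy-Schwarz alone gives the inequality without the factor \<open>D\<close>. The gain
  comes from the multiplicity of the largest singular value, which is the degree of a representation
  that is nontrivial on \<open>K\<close>.\<close>

lemma conv_norm_bound:
  assumes f: "\<And>x. x \<in> carrier G \<Longrightarrow> (\<Sum>z\<in>K. f (x \<otimes> z)) = 0"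
    and rep: "\<And>d \<rho>. \<rho> \<in> hom G (GL_complex d) \<Longrightarrow> \<exists>z\<in>K. \<rho> z \<noteq> 1\<^sub>m d \<Longrightarrow> D \<le> real d"
  shows "D * norm2 (conv f g) \<le> card (carrier G) * norm2 f * norm2 g"
proof -
  let ?S = "carrier G"
  have "?S \<noteq> {}" by auto
  then obtain L f0 where f0: "norm2 f0 = 1" "norm2 (conv f f0) = L"
    and L: "\<And>g. norm2 (conv f g) \<le> L * norm2 g"
    unfolding conv_eq_kernel_on using kernel_on_norm_attained[OF finite_carrier] by metis
  have "L \<ge> 0" using f0 dot_on_self_nonneg by metis
  show ?thesis
  proof (cases "L = 0")
    case True
    then have "norm2 (conv f g) = 0"
      using L[of g] dot_on_self_nonneg[of ?S "conv f g"] by simp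
    then show ?thesis by simp
  next
    case False
    \<comment> \<open>The eigenspace for the top eigenvalue \<open>L\<close> of the adjoint of
      \<open>conv f\<close> composed with \<open>conv f\<close>, described by equality in the norm
      bound.\<close>
    define V where "V = {h. norm2 (conv f h) = L * norm2 h}"
    have V_add: "(\<lambda>x. h x + h' x) \<in> V" if "h \<in> V" "h' \<in> V" for h h'
      using that L norm_attaining_add[of ?S "\<lambda>x y. f (x \<otimes> inv y)" L h h']
      by (simp add: V_def conv_eq_kernel_on)
    have conv_scale: "conv f (\<lambda>x. c * h x) = (\<lambda>x. c * conv f h x)" for c h
      by (intro ext) (simp add: conv_eq_kernel_on kernel_on_def dot_on_scale_right)
    have V_scale: "(\<lambda>x. c * h x) \<in> V" if "h \<in> V" for c h
      using that by (simp add: V_def conv_scale dot_on_linear)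
    obtain m u where u: "orthonormal_on ?S m u" "\<And>i. i < m \<Longrightarrow> u i \<in> V"
      and expand: "\<And>h x. h \<in> V \<Longrightarrow> x \<in> ?S \<Longrightarrow> h x = (\<Sum>i<m. dot_on ?S h (u i) * u i x)"
      by (rule orthonormal_basis_on_exists[OF finite_carrier V_add V_scale], assumption+)
        (rule that, assumption+)
    define R where "R a h = (\<lambda>x. h (x \<otimes> a))" for a and h :: "'a \<Rightarrow> real"
    have V_R: "R a h \<in> V" if "h \<in> V" "a \<in> ?S" for a h
    proof -
      have "norm2 (conv f (R a h)) = dot_on ?S (\<lambda>x. conv f h (x \<otimes> a)) (\<lambda>x. conv f h (x \<otimes> a))"
        unfolding R_def using that(2) by (intro dot_on_cong conv_translate)
      also have "\<dots> = norm2 (conv f h)"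
        unfolding dot_on_def by (rule sum_translate_right[OF that(2)])
      also have "\<dots> = L * norm2 h" using that(1) by (simp add: V_def)
      also have "norm2 h = norm2 (R a h)"
        unfolding dot_on_def R_def by (rule sum_translate_right[OF that(2), symmetric])
      finally show ?thesis by (simp add: V_def)
    qed
    \<comment> \<open>Column \<open>j\<close> holds the coordinates of \<open>R a (u j)\<close> in
      the basis \<open>u\<close>.\<close>
    define M where "M a i j = dot_on ?S (R a (u j)) (u i)" for a i j
    have M_mult: "M (a \<otimes> b) i j = (\<Sum>l<m. M a i l * M b l j)"
      if "a \<in> ?S" "b \<in> ?S" "i < m" "j < m" for a b i j
    proof -
      have "M (a \<otimes> b) i j = dot_on ?S (\<lambda>x. \<Sum>l<m. M b l j * R a (u l) x) (u i)"
        unfolding M_def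
      proof (intro dot_on_cong refl)
        fix x assume x: "x \<in> ?S"
        have "R (a \<otimes> b) (u j) x = R b (u j) (x \<otimes> a)"
          using x that by (simp add: R_def m_assoc)
        also have "\<dots> = (\<Sum>l<m. dot_on ?S (R b (u j)) (u l) * u l (x \<otimes> a))"
          using x that by (intro expand V_R u) auto
        finally show "R (a \<otimes> b) (u j) x = (\<Sum>l<m. dot_on ?S (R b (u j)) (u l) * R a (u l) x)"
          by (simp add: R_def)
      qed
      then show ?thesis
        by (simp add: dot_on_sum_left dot_on_scale_left) (simp add: M_def mult.commute)
    qed
    have M_one: "M \<one> i j = (if i = j then 1 else 0)" if "i < m" "j < m" for i j
    proof -
      have "M \<one> i j = dot_on ?S (u j) (u i)"
        unfolding M_def by (rule dot_on_cong) (simp_all add: R_def)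
      then show ?thesis using u(1) that by (auto simp: orthonormal_on_def)
    qed
    define \<rho> where "\<rho> a = mat m m (\<lambda>(i, j). complex_of_real (M a i j))" for a
    have \<rho>_mult: "\<rho> (a \<otimes> b) = \<rho> a * \<rho> b" if "a \<in> ?S" "b \<in> ?S" for a b
      using that by (intro eq_matI) (auto simp: \<rho>_def M_mult scalar_prod_def atLeast0LessThan)
    have \<rho>_one: "\<rho> \<one> = 1\<^sub>m m"
      by (intro eq_matI) (auto simp: \<rho>_def M_one)
    have \<rho>_Units: "\<rho> a \<in> Units (ring_mat TYPE(complex) m ())" if "a \<in> ?S" for a
    proof -
      have "\<rho> (inv a) * \<rho> a = 1\<^sub>m m" "\<rho> a * \<rho> (inv a) = 1\<^sub>m m"
        using that by (simp_all flip: \<rho>_mult add: \<rho>_one)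
      moreover have "\<rho> b \<in> carrier_mat m m" for b by (simp add: \<rho>_def)
      ultimately show ?thesis
        by (auto simp: Units_def ring_mat_def)
    qed
    have hom: "\<rho> \<in> hom G (GL_complex m)"
      using \<rho>_Units \<rho>_mult
      by (auto simp: hom_def GL_complex_def units_of_def ring_mat_def)
    \<comment> \<open>The maximiser \<open>f0\<close> lies in \<open>V\<close>. Over an empty basis
      its expansion would vanish, against its norm 1.\<close>
    have "m \<noteq> 0"
    proof
      assume "m = 0"
      then have "\<forall>x\<in>?S. f0 x = 0"
        using expand[of f0] f0 by (simp add: V_def)
      then show False using f0 dot_on_self_eq_0[OF finite_carrier, of f0] by simp
    qed
    \<comment> \<open>Otherwise \<open>u 0\<close> would be constant on the cosets of
      \<open>K\<close>, hence killed by \<open>conv f\<close>, although its image has squared norm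
      \<open>L\<close>, which is nonzero here.\<close>
    have "\<exists>z\<in>K. \<rho> z \<noteq> 1\<^sub>m m"
    proof (rule ccontr)
      assume "\<not> ?thesis"
      then have triv: "\<rho> z = 1\<^sub>m m" if "z \<in> K" for z using that by blast
      have fixed: "u 0 (x \<otimes> z) = u 0 x" if "x \<in> ?S" "z \<in> K" for x z
      proof -
        have "M z i 0 = (if i = 0 then 1 else 0)" if "i < m" for i
        proof -
          have "\<rho> z $$ (i, 0) = 1\<^sub>m m $$ (i, 0)" using triv[OF \<open>z \<in> K\<close>] by simp
          then show ?thesis using that \<open>m \<noteq> 0\<close> by (simp add: \<rho>_def split: if_splits)
        qed
        then have "(\<Sum>i<m. M z i 0 * u i x) = (\<Sum>i<m. if i = 0 then u i x else 0)"
          by (intro sum.cong) auto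
        moreover have "R z (u 0) x = (\<Sum>i<m. M z i 0 * u i x)"
          unfolding M_def using that \<open>m \<noteq> 0\<close> by (intro expand V_R u) auto
        ultimately show ?thesis using \<open>m \<noteq> 0\<close> by (simp add: R_def)
      qed
      have "conv f (u 0) x = 0" if "x \<in> ?S" for x
        using that by (intro conv_eq_0 f fixed)
      then have "norm2 (conv f (u 0)) = 0"
        by (simp add: dot_on_self_eq_0 finite_carrier)
      moreover have "norm2 (conv f (u 0)) = L"
        using u \<open>m \<noteq> 0\<close> by (auto simp: V_def orthonormal_on_def)
      ultimately show False using False by simp
    qed
    with rep[OF hom] have "D \<le> real m" .
    \<comment> \<open>Every basis vector contributes \<open>L\<close> to the trace, while each of
      the \<open>card ?S\<close> rows of the kernel is a rearrangement of \<open>f\<close>.\<close>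
    have "m * L = (\<Sum>i<m. norm2 (conv f (u i)))"
      using u by (simp add: V_def orthonormal_on_def)
    also have "\<dots> \<le> (\<Sum>x\<in>?S. norm2 (\<lambda>y. f (x \<otimes> inv y)))"
      unfolding conv_eq_kernel_on by (rule kernel_on_trace_bound[OF u(1)])
    also have "\<dots> = (\<Sum>x\<in>?S. norm2 f)"
      unfolding dot_on_def by (intro sum.cong refl sum_inv_translate)
    finally have trace: "m * L \<le> card ?S * norm2 f" by simp
    show ?thesis
    proof (cases "D \<ge> 0")
      case True
      have "D * norm2 (conv f g) \<le> m * (L * norm2 g)"
        using \<open>D \<le> real m\<close> True L[of g] by (intro mult_mono) auto
      also have "\<dots> \<le> card ?S * norm2 f * norm2 g"
        using mult_right_mono[OF trace, of "norm2 g"] by (simp add: mult.assoc)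
      finally show ?thesis .
    next
      case False
      then have "D * norm2 (conv f g) \<le> 0"
        by (simp add: mult_nonpos_nonneg)
      also have "\<dots> \<le> card ?S * norm2 f * norm2 g" by simp
      finally show ?thesis .
    qed
  qed
qed

section \<open>Iterated convolutions\<close>

text \<open>Starts from the point mass at \<open>\<one>\<close>, a unit for convolution, so that
  \<open>convs f k\<close> is the convolution of \<open>f 1\<close> to \<open>f k\<close> in this
  order.\<close>

primrec convs :: "(nat \<Rightarrow> 'a \<Rightarrow> real) \<Rightarrow> nat \<Rightarrow> 'a \<Rightarrow> real" where
  "convs f 0 = (\<lambda>x. of_bool (x = \<one>))"
| "convs f (Suc k) = conv (convs f k) (f (Suc k))"

lemma convs_1:
  assumes "x \<in> carrier G"
  shows "convs f (Suc 0) x = f (Suc 0) x"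
proof -
  have "convs f (Suc 0) x = (\<Sum>y\<in>carrier G. if y = x then f (Suc 0) y else 0)"
    unfolding convs.simps conv_def
  proof (intro sum.cong refl)
    fix y assume "y \<in> carrier G"
    then have "x \<otimes> inv y = \<one> \<longleftrightarrow> y = x"
      using assms by (metis inv_equality inv_inv r_inv inv_closed)
    then show "of_bool (x \<otimes> inv y = \<one>) * f (Suc 0) y = (if y = x then f (Suc 0) y else 0)"
      by simp
  qed
  then show ?thesis using assms finite_carrier by simp
qed

lemma dev_cong:
  assumes "\<And>y. y \<in> carrier G \<Longrightarrow> f y = g y" "x \<in> carrier G"
  shows "dev f x = dev g x"
  using assms by (simp add: dev_def avg_def)

text \<open>By \<open>conv_dev\<close>, \<open>dev\<close> can be moved to the left factor, which
  then has sum zero on each coset as \<open>conv_norm_bound\<close> requires. Joining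
  \<open>Suc k\<close> functions takes \<open>k\<close> convolutions, each costing one factor
  \<open>card (carrier G) / D\<close>; the first function costs nothing, as \<open>dev\<close> does
  not increase norms.\<close>

lemma norm2_dev_convs:
  assumes rep: "\<And>d \<rho>. \<rho> \<in> hom G (GL_complex d) \<Longrightarrow> \<exists>z\<in>K. \<rho> z \<noteq> 1\<^sub>m d \<Longrightarrow> D \<le> real d"
    and D: "D > 0"
  shows "D ^ k * norm2 (dev (convs f (Suc k)))
    \<le> real (card (carrier G)) ^ k * (\<Prod>i=1..Suc k. norm2 (f i))"
proof (induction k)
  case 0
  have "norm2 (dev (convs f (Suc 0))) = norm2 (dev (f (Suc 0)))"
    by (intro dot_on_cong dev_cong convs_1)
  then show ?case using norm2_dev_le[of "f (Suc 0)"] by simp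
next
  case (Suc k)
  let ?C = "convs f (Suc k)" and ?f = "f (Suc (Suc k))" and ?n = "real (card (carrier G))"
  have "norm2 (dev (convs f (Suc (Suc k)))) = norm2 (conv (dev ?C) ?f)"
    unfolding convs.simps(2)[of f "Suc k"] by (intro dot_on_cong conv_dev[symmetric])
  then have "D ^ Suc k * norm2 (dev (convs f (Suc (Suc k))))
    = D ^ k * (D * norm2 (conv (dev ?C) ?f))"
    by simp
  also have "\<dots> \<le> D ^ k * (?n * norm2 (dev ?C) * norm2 ?f)"
    using D by (intro mult_left_mono conv_norm_bound sum_K_dev rep) auto
  also have "\<dots> = (?n * norm2 ?f) * (D ^ k * norm2 (dev ?C))"
    by (simp only: mult_ac)
  also have "\<dots> \<le> (?n * norm2 ?f) * (?n ^ k * (\<Prod>i=1..Suc k. norm2 (f i)))"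
    by (intro mult_left_mono Suc.IH) auto
  finally show ?case by (simp add: mult_ac)
qed

section \<open>Counting products of group elements\<close>

lemma foldr_mult_closed: "set xs \<subseteq> carrier G \<Longrightarrow> foldr (\<otimes>) xs \<one> \<in> carrier G"
  by (induction xs) auto

text \<open>\<open>foldr\<close> brackets to the right, whereas \<open>convs\<close> appends its
  factors on the right; associativity reconciles the two.\<close>

lemma foldr_mult_snoc:
  "set xs \<subseteq> carrier G \<Longrightarrow> a \<in> carrier G \<Longrightarrow> foldr (\<otimes>) (xs @ [a]) \<one> = foldr (\<otimes>) xs \<one> \<otimes> a"
proof (induction xs)
  case (Cons b xs)
  then show ?case using foldr_mult_closed[of xs] by (simp add: m_assoc)
qed simp

lemma ordered_prod_closed:
  assumes "\<And>i. i \<in> {1..k} \<Longrightarrow> x i \<in> carrier G"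
  shows "ordered_prod G k x \<in> carrier G"
  unfolding ordered_prod_def using assms by (intro foldr_mult_closed) auto

lemma ordered_prod_Suc:
  assumes "\<And>i. i \<in> {1..Suc k} \<Longrightarrow> x i \<in> carrier G"
  shows "ordered_prod G (Suc k) x = ordered_prod G k x \<otimes> x (Suc k)"
proof -
  have "set (map x [1..<Suc k]) \<subseteq> carrier G" "x (Suc k) \<in> carrier G"
    using assms by auto
  from foldr_mult_snoc[OF this] show ?thesis
    by (simp add: ordered_prod_def upt_Suc_append[of "Suc 0" "Suc k"] del: upt_Suc foldr_append)
qed

text \<open>For indicators, \<open>convs\<close> at \<open>g\<close> counts the ways to write
  \<open>g\<close> as a product of elements of \<open>X 1\<close> to \<open>X k\<close>. The weight
  \<open>w\<close> is arbitrary because the induction replaces it by its translate by the last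
  factor.\<close>

lemma sum_ordered_prod:
  assumes "\<And>i. i \<in> {1..k} \<Longrightarrow> X i \<subseteq> carrier G"
  shows "(\<Sum>x\<in>PiE {1..k} X. w (ordered_prod G k x))
    = (\<Sum>g\<in>carrier G. convs (\<lambda>i. indicator (X i)) k g * w g :: real)"
  using assms
proof (induction k arbitrary: w)
  case 0
  have "(\<Sum>g\<in>carrier G. of_bool (g = \<one>) * w g) = (\<Sum>g\<in>carrier G. if g = \<one> then w g else 0)"
    by (rule sum.cong) auto
  then show ?case using finite_carrier by (simp add: ordered_prod_def)
next
  case (Suc k)
  let ?C = "convs (\<lambda>i. indicator (X i)) k" and ?Y = "X (Suc k)"
  have Y: "?Y \<subseteq> carrier G" using Suc.prems by simp
  have split: "{1..Suc k} = insert (Suc k) {1..k}" by auto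
  have "(\<Sum>x\<in>PiE {1..Suc k} X. w (ordered_prod G (Suc k) x))
    = (\<Sum>a\<in>?Y. \<Sum>x\<in>PiE {1..k} X. w (ordered_prod G (Suc k) (x(Suc k := a))))"
    unfolding split by (rule sum_PiE_insert) simp
  also have "\<dots> = (\<Sum>a\<in>?Y. \<Sum>x\<in>PiE {1..k} X. w (ordered_prod G k x \<otimes> a))"
  proof (intro sum.cong refl)
    fix a x assume a: "a \<in> ?Y" and x: "x \<in> PiE {1..k} X"
    have "(x(Suc k := a)) i \<in> carrier G" if i: "i \<in> {1..Suc k}" for i
    proof (cases "i = Suc k")
      case False
      then have "i \<in> {1..k}" using i by auto
      then show ?thesis using PiE_mem[OF x] Suc.prems[OF i] False by auto
    qed (use a Y in auto)
    then have "ordered_prod G (Suc k) (x(Suc k := a)) = ordered_prod G k (x(Suc k := a)) \<otimes> a"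
      using ordered_prod_Suc[of k "x(Suc k := a)"] unfolding fun_upd_same by blast
    also have "ordered_prod G k (x(Suc k := a)) = ordered_prod G k x"
      unfolding ordered_prod_def by (intro arg_cong2[of _ _ _ _ "foldr (\<otimes>)"] map_cong refl) auto
    finally show "w (ordered_prod G (Suc k) (x(Suc k := a))) = w (ordered_prod G k x \<otimes> a)"
      by (rule arg_cong)
  qed
  also have "\<dots> = (\<Sum>a\<in>?Y. \<Sum>g\<in>carrier G. ?C g * w (g \<otimes> a))"
    using Suc.prems by (intro sum.cong refl Suc.IH) auto
  also have "\<dots> = (\<Sum>a\<in>?Y. \<Sum>g\<in>carrier G. ?C (g \<otimes> inv a) * w g)"
  proof (rule sum.cong[OF refl])
    fix a assume "a \<in> ?Y"
    then have a: "a \<in> carrier G" using Y by blast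
    have "(\<Sum>g\<in>carrier G. ?C g * w (g \<otimes> a)) = (\<Sum>g\<in>carrier G. ?C (g \<otimes> a \<otimes> inv a) * w (g \<otimes> a))"
      using a by (intro sum.cong) (auto simp: m_assoc)
    then show "(\<Sum>g\<in>carrier G. ?C g * w (g \<otimes> a)) = (\<Sum>g\<in>carrier G. ?C (g \<otimes> inv a) * w g)"
      using sum_translate_right[OF a, of "\<lambda>g. ?C (g \<otimes> inv a) * w g"] by simp
  qed
  also have "\<dots> = (\<Sum>a\<in>carrier G. indicator ?Y a * (\<Sum>g\<in>carrier G. ?C (g \<otimes> inv a) * w g))"
    using Y finite_carrier by (intro sum.mono_neutral_cong_left) auto
  also have "\<dots> = (\<Sum>g\<in>carrier G. convs (\<lambda>i. indicator (X i)) (Suc k) g * w g)"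
    unfolding convs.simps conv_def sum_distrib_left sum_distrib_right
    by (subst sum.swap) (simp only: mult_ac)
  finally show ?case .
qed

text \<open>The relation \<open>P\<close> between target and product is left open to cover both
  counts: equality, and membership in the same coset of \<open>K\<close>.\<close>

lemma card_solutions:
  assumes X: "\<And>i. i \<le> k \<Longrightarrow> X i \<subseteq> carrier G"
  shows "real (card {x \<in> PiE {..k} X. P (x 0) (ordered_prod G k x)})
    = (\<Sum>a\<in>X 0. \<Sum>g\<in>carrier G. convs (\<lambda>i. indicator (X i)) k g * of_bool (P a g))"
proof -
  have split: "{..k} = insert 0 {1..k}" by auto
  have "finite (PiE {..k} X)"
    using X finite_carrier by (intro finite_PiE) (auto intro: finite_subset)
  then have "real (card {x \<in> PiE {..k} X. P (x 0) (ordered_prod G k x)})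
    = (\<Sum>x\<in>PiE {..k} X. of_bool (P (x 0) (ordered_prod G k x)))"
    by (simp add: sum.If_cases of_bool_def Collect_conj_eq Int_commute)
  also have "\<dots> = (\<Sum>x\<in>PiE (insert 0 {1..k}) X. of_bool (P (x 0) (ordered_prod G k x)))"
    unfolding split ..
  also have "(\<Sum>x\<in>PiE (insert 0 {1..k}) X. of_bool (P (x 0) (ordered_prod G k x)))
    = (\<Sum>a\<in>X 0. \<Sum>x\<in>PiE {1..k} X. of_bool (P ((x(0 := a)) 0) (ordered_prod G k (x(0 := a)))) :: real)"
    by (rule sum_PiE_insert) simp
  also have "\<dots> = (\<Sum>a\<in>X 0. \<Sum>x\<in>PiE {1..k} X. of_bool (P a (ordered_prod G k x)))"
  proof (intro sum.cong refl)
    fix a x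
    have "ordered_prod G k (x(0 := a)) = ordered_prod G k x"
      unfolding ordered_prod_def by (intro arg_cong2[of _ _ _ _ "foldr (\<otimes>)"] map_cong refl) auto
    then show "of_bool (P ((x(0 := a)) 0) (ordered_prod G k (x(0 := a)))) = (of_bool (P a (ordered_prod G k x)) :: real)"
      by simp
  qed
  also have "\<dots> = (\<Sum>a\<in>X 0. \<Sum>g\<in>carrier G. convs (\<lambda>i. indicator (X i)) k g * of_bool (P a g))"
    using X by (intro sum.cong refl sum_ordered_prod) auto
  finally show ?thesis .
qed

section \<open>The mixing inequality relative to a normal subgroup\<close>

theorem product_mixing:
  assumes rep: "\<And>d \<rho>. \<rho> \<in> hom G (GL_complex d) \<Longrightarrow> \<exists>z\<in>K. \<rho> z \<noteq> 1\<^sub>m d \<Longrightarrow> D \<le> real d"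
    and D: "D > 0" and k: "k \<ge> 1"
    and X: "\<And>i. i \<le> k \<Longrightarrow> X i \<subseteq> carrier G"
  shows "\<bar>real (card {x \<in> PiE {..k} X. ordered_prod G k x = x 0})
      - 1 / real (card K) * real (card {x \<in> PiE {..k} X. ordered_prod G k x \<in> x 0 <# K})\<bar>
    \<le> sqrt (real (card (carrier G)) ^ (k - 1) * (\<Prod>i\<le>k. real (card (X i))) / D ^ (k - 1))"
proof -
  let ?S = "carrier G"
  define f where "f i = (indicator (X i) :: 'a \<Rightarrow> real)" for i
  define C where "C = convs f k"
  have split: "{..k} = insert 0 {1..k}" by auto
  have norm2_f: "norm2 (f i) = card (X i)" if "i \<le> k" for i
  proof -
    have "norm2 (f i) = (\<Sum>x\<in>X i. 1)"
      unfolding dot_on_def f_def using X[OF that] finite_carrier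
      by (intro sum.mono_neutral_cong_right) auto
    then show ?thesis by simp
  qed
  have "real (card {x \<in> PiE {..k} X. ordered_prod G k x = x 0})
    = (\<Sum>a\<in>X 0. \<Sum>g\<in>?S. C g * of_bool (g = a))"
    using card_solutions[OF X, where P = "\<lambda>a g. g = a"] by (simp add: C_def f_def[abs_def])
  also have "\<dots> = (\<Sum>a\<in>X 0. C a)"
  proof (intro sum.cong refl)
    fix a assume a: "a \<in> X 0"
    have "(\<Sum>g\<in>?S. C g * of_bool (g = a)) = (\<Sum>g\<in>?S. if g = a then C g else 0)"
      by (rule sum.cong) auto
    then show "(\<Sum>g\<in>?S. C g * of_bool (g = a)) = C a"
      using a X[of 0] finite_carrier by auto
  qed
  finally have count: "real (card {x \<in> PiE {..k} X. ordered_prod G k x = x 0}) = (\<Sum>a\<in>X 0. C a)" .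
  have "real (card {x \<in> PiE {..k} X. ordered_prod G k x \<in> x 0 <# K})
    = (\<Sum>a\<in>X 0. \<Sum>g\<in>?S. C g * of_bool (g \<in> a <# K))"
    using card_solutions[OF X, where P = "\<lambda>a g. g \<in> a <# K"] by (simp add: C_def f_def[abs_def])
  \<comment> \<open>Summing \<open>C\<close> over the coset of \<open>a\<close> gives
    \<open>card K\<close> times its mean there, so after division by \<open>card K\<close> the two
    counts differ by the sum of \<open>dev C\<close> over \<open>X 0\<close>.\<close>
  also have "\<dots> = (\<Sum>a\<in>X 0. card K * avg C a)"
  proof (intro sum.cong refl)
    fix a assume "a \<in> X 0"
    then have a: "a \<in> ?S" using X[of 0] by auto
    have coset: "a <# K = (\<lambda>z. a \<otimes> z) ` K" by (auto simp: l_coset_def)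
    have "(\<Sum>g\<in>?S. C g * of_bool (g \<in> a <# K)) = (\<Sum>g\<in>a <# K. C g)"
      using a finite_carrier by (intro sum.mono_neutral_cong_right) (auto simp: coset)
    also have "\<dots> = (\<Sum>z\<in>K. C (a \<otimes> z))"
      unfolding coset using a by (subst sum.reindex) (auto simp: inj_on_def)
    also have "\<dots> = card K * avg C a"
      using card_K_pos by (simp add: avg_def)
    finally show "(\<Sum>g\<in>?S. C g * of_bool (g \<in> a <# K)) = card K * avg C a" .
  qed
  finally have "1 / real (card K) * real (card {x \<in> PiE {..k} X. ordered_prod G k x \<in> x 0 <# K})
    = (\<Sum>a\<in>X 0. avg C a)"
    using card_K_pos by (simp flip: sum_distrib_left)
  then have "real (card {x \<in> PiE {..k} X. ordered_prod G k x = x 0})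
      - 1 / real (card K) * real (card {x \<in> PiE {..k} X. ordered_prod G k x \<in> x 0 <# K})
    = (\<Sum>a\<in>X 0. dev C a)" (is "?diff = _")
    by (simp add: count dev_def sum_subtractf)
  also have "\<dots> = dot_on ?S (f 0) (dev C)"
    unfolding dot_on_def f_def using X[of 0] finite_carrier
    by (intro sum.mono_neutral_cong_left) auto
  finally have "?diff\<^sup>2 \<le> norm2 (f 0) * norm2 (dev C)"
    using dot_on_Cauchy_Schwarz by simp
  \<comment> \<open>\<open>k\<close> factors need \<open>k - 1\<close> convolutions, whence the
    exponent.\<close>
  also have "norm2 (dev C) \<le> real (card ?S) ^ (k - 1) * (\<Prod>i=1..k. norm2 (f i)) / D ^ (k - 1)"
    using norm2_dev_convs[OF rep D, where k = "k - 1" and f = f] k D by (simp add: C_def field_simps)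
  also have "(\<Prod>i=1..k. norm2 (f i)) = (\<Prod>i=1..k. real (card (X i)))"
    by (intro prod.cong) (auto simp: norm2_f)
  finally have "?diff\<^sup>2 \<le> card (X 0)
      * (real (card ?S) ^ (k - 1) * (\<Prod>i=1..k. real (card (X i))) / D ^ (k - 1))"
    by (simp add: norm2_f mult_left_mono)
  also have "card (X 0) * (real (card ?S) ^ (k - 1) * (\<Prod>i=1..k. real (card (X i))) / D ^ (k - 1))
    = real (card ?S) ^ (k - 1) * (\<Prod>i\<le>k. real (card (X i))) / D ^ (k - 1)"
    unfolding split by simp
  finally show ?thesis
    by (rule real_le_rsqrt[of "\<bar>?diff\<bar>", unfolded power2_abs])
qed

end

section \<open>The case of a semidirect product\<close>

theorem theorem2:
  fixes N :: "('a, 'm) monoid_scheme" and H :: "('b, 'n) monoid_scheme"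
    and \<phi> :: "'b \<Rightarrow> 'a \<Rightarrow> 'a" and D :: real
    and k :: nat and X :: "nat \<Rightarrow> ('a \<times> 'b) set"
  assumes "group N" and "finite (carrier N)"
    and "group H" and "finite (carrier H)"
    and "\<phi> \<in> hom H (AutoGroup N)"
    and "D > 0" and "quasirandom_on D N H \<phi>"
    and "k \<ge> 2"
    and "\<And>i. i \<le> k \<Longrightarrow> X i \<subseteq> carrier (semidirect_product N H \<phi>)"
  shows "\<bar>real (solution_count N H \<phi> k X)
            - 1 / real (card (carrier N)) * real (projected_solution_count H k X)\<bar>
         \<le> sqrt (real (card (carrier (semidirect_product N H \<phi>))) ^ (k - 1)
                  * (\<Prod>i\<le>k. real (card (X i))) / D ^ (k - 1))"
proof -
  define G where "G = semidirect_product N H \<phi>"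
  define K where "K = carrier N \<times> {\<one>\<^bsub>H\<^esub>}"
  interpret N: group N by fact
  interpret H: group H by fact
  interpret G: group G
    unfolding G_def by (intro group_semidirect_product assms)
  interpret snd: group_hom G H snd
    by unfold_locales (auto simp: hom_def G_def semidirect_product_def)
  have carrier_G: "carrier G = carrier N \<times> carrier H"
    by (simp add: G_def semidirect_product_def)
  \<comment> \<open>The copy of \<open>N\<close> in \<open>G\<close> is the kernel of the projection
    to \<open>H\<close>. This gives its normality and identifies its cosets with the fibres of
    \<open>snd\<close>.\<close>
  have kernel: "kernel G H snd = K"
    by (auto simp: kernel_def carrier_G K_def)
  have "K \<lhd> G"
    using snd.normal_kernel by (simp add: kernel)
  then interpret finite_normal K G
    using assms(2,4) by (simp add: finite_normal_def finite_normal_axioms_def carrier_G)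
  have X: "X i \<subseteq> carrier G" if "i \<le> k" for i
    using assms(9)[OF that] by (simp add: G_def)
  \<comment> \<open>Nontriviality on \<open>K\<close> is exactly the type II condition.\<close>
  have rep: "D \<le> real d" if "\<rho> \<in> hom G (GL_complex d)" "\<exists>z\<in>K. \<rho> z \<noteq> 1\<^sub>m d" for d \<rho>
    using assms(7) that
    by (auto simp: quasirandom_on_def type_II_representation_def complex_representation_def G_def K_def)
  have snd_prod: "ordered_prod H k (\<lambda>i. snd (x i)) = snd (ordered_prod G k x)" for x
  proof -
    have "foldr (\<otimes>\<^bsub>H\<^esub>) (map (\<lambda>i. snd (x i)) is) \<one>\<^bsub>H\<^esub> = snd (foldr (\<otimes>\<^bsub>G\<^esub>) (map x is) \<one>\<^bsub>G\<^esub>)" for "is"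
      by (induction "is") (auto simp: G_def semidirect_product_def split_beta)
    then show ?thesis by (simp add: ordered_prod_def)
  qed
  \<comment> \<open>This turns the projected equation into the coset condition of
    \<open>product_mixing\<close>.\<close>
  have coset: "snd p = snd a \<longleftrightarrow> p \<in> a <#\<^bsub>G\<^esub> K" if "p \<in> carrier G" "a \<in> carrier G" for p a
  proof
    assume eq: "snd p = snd a"
    have "snd (inv\<^bsub>G\<^esub> a \<otimes>\<^bsub>G\<^esub> p) = inv\<^bsub>H\<^esub> snd a \<otimes>\<^bsub>H\<^esub> snd p"
      using that by simp
    also have "\<dots> = \<one>\<^bsub>H\<^esub>"
      unfolding eq using that by simp
    finally have "inv\<^bsub>G\<^esub> a \<otimes>\<^bsub>G\<^esub> p \<in> K"
      unfolding kernel[symmetric] kernel_def using that by simp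
    moreover have "p = a \<otimes>\<^bsub>G\<^esub> (inv\<^bsub>G\<^esub> a \<otimes>\<^bsub>G\<^esub> p)"
      using that by (simp flip: G.m_assoc)
    ultimately show "p \<in> a <#\<^bsub>G\<^esub> K"
      unfolding l_coset_def by blast
  next
    assume "p \<in> a <#\<^bsub>G\<^esub> K"
    then obtain z where z: "z \<in> K" "p = a \<otimes>\<^bsub>G\<^esub> z"
      unfolding l_coset_def by blast
    then have "snd z = \<one>\<^bsub>H\<^esub>"
      by (auto simp: K_def)
    then show "snd p = snd a"
      using z that by simp
  qed
  have "{x \<in> PiE {..k} X. ordered_prod H k (\<lambda>i. snd (x i)) = snd (x 0)}
    = {x \<in> PiE {..k} X. ordered_prod G k x \<in> x 0 <#\<^bsub>G\<^esub> K}"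
  proof (intro Collect_cong conj_cong refl)
    fix x assume x: "x \<in> PiE {..k} X"
    then have "x i \<in> carrier G" if "i \<le> k" for i
      using X[OF that] that by auto
    then show "ordered_prod H k (\<lambda>i. snd (x i)) = snd (x 0) \<longleftrightarrow> ordered_prod G k x \<in> x 0 <#\<^bsub>G\<^esub> K"
      unfolding snd_prod by (intro coset ordered_prod_closed) auto
  qed
  moreover have "card K = card (carrier N)"
    by (simp add: K_def card_cartesian_product)
  ultimately show ?thesis
    using product_mixing[OF rep \<open>D > 0\<close> _ X] \<open>k \<ge> 2\<close>
    by (simp add: solution_count_def projected_solution_count_def flip: G_def)
qed

end
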